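(* Consider the plant, the data matrices $\Psi_0,\Psi_1$ and the unknown matrix $W_0$ defined in the context. Suppose that all eigenvalues of $S$ belong to $\{z\in\mathbb{C}: |z|\ge 1\}$, that the pair $(A,C)$ is observable with (known) observability index $\ell$, and that there are a matrix $\hat L_0$ and a (known) matrix $\hat{\mathbf M}\in\mathbb{R}^{\hat n_w\times(T-\ell+1)}$ such that $W_0=\hat L_0\hat{\mathbf M}$. Let $N:=(m+p)\ell+pd$. If $\hat{\mathbf M}$ has full row rank and $p\ell>n$, then the semidefinite program $$\mathcal X\succ 0,\qquad \begin{bmatrix}\mathcal X\\ 0_{\hat n_w,N}\end{bmatrix}=\begin{bmatrix}\Psi_0\\ \hat{\mathbf M}\end{bmatrix}\mathcal Y,\qquad \begin{bmatrix}\mathcal X & \Psi_1\mathcal Y\\ (\Psi_1\mathcal Y)^\top & \mathcal X\end{bmatrix}\succ 0$$ in the decision variables $\mathcal X\in\mathbb{R}^{N\times N}$ symmetric and $\mathcal Y\in\mathbb{R}^{(T-\ell+1)\times N}$ is infeasible.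
   Context: All vectors and matrices are real. $x^+$ denotes the value of $x$ at the next time step (discrete time); $M\succ0$ means symmetric positive definite; $(x_1,\dots,x_k)$ denotes the stacked column vector. Plant: $w^+=Sw$, $x^+=Ax+Bu+Pw$, $y=Cx+Qw$ with $w\in\mathbb{R}^{n_w}$ (exosignal), $x\in\mathbb{R}^n$, $u\in\mathbb{R}^m$, $y\in\mathbb{R}^p$. Observability index: if $(A,C)$ is observable, $\ell$ is the smallest integer $l\ge1$ such that the stacked matrix with block rows $C,CA,\dots,CA^{l-1}$ has rank $n$. Internal model: let $\lambda^d+s_{d-1}\lambda^{d-1}+\dots+s_1\lambda+s_0$ be the minimal polynomial of $S$. $\Phi\in\mathbb{R}^{pd\times pd}$ is the block companion matrix with $d\times d$ blocks of size $p\times p$: for $i=1,\dots,d-1$ its $i$-th block row has $I_p$ in block column $i+1$ and zeros elsewhere, and its last block row is $[-s_0I_p,\,-s_1I_p,\dots,-s_{d-1}I_p]$. $G\in\mathbb{R}^{pd\times p}$ has $I_p$ as last block and zeros elsewhere. The internal model is $\eta^+=\Phi\eta+Gy$. Data: for an integer $T\ge\ell$, a trajectory of the plant and of the internal model is collected (arbitrary initial $w(0),x(0),\eta(0)$ and input sequence $u(0),\dots,u(T)$). For $k=\ell,\dots,T+1$ let $\psi(k):=(y(k-\ell),\dots,y(k-1),u(k-\ell),\dots,u(k-1),\eta(k))\in\mathbb{R}^{(m+p)\ell+pd}$. Define $\Psi_0:=[\psi(\ell)\ \psi(\ell+1)\ \cdots\ \psi(T)]$, $\Psi_1:=[\psi(\ell+1)\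 \psi(\ell+2)\ \cdots\ \psi(T+1)]$, $W_0:=[w(\ell)\ w(\ell+1)\ \cdots\ w(T)]$. *)

theory Defs
  imports
    "Jordan_Normal_Form.DL_Rank"
    "Jordan_Normal_Form.Spectral_Radius"
    "HOL-Computational_Algebra.Polynomial"
begin

text \<open>Dimensions are natural numbers fixed by carrier sets, since \<open>\<psi>(k)\<close> has a length that depends
  on the observability index and on the degree of the minimal polynomial of \<open>S\<close>. Vector and matrix
  indices start at 0, so the block \<open>b\<close> of size \<open>q\<close> occupies the indices \<open>b * q + r\<close> with \<open>r < q\<close>.\<close>

definition pos_def_mat :: "nat \<Rightarrow> real mat \<Rightarrow> bool" where
  "pos_def_mat n M \<longleftrightarrow> M \<in> carrier_mat n n \<and> M\<^sup>T = M \<and>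
     (\<forall>v \<in> carrier_vec n. v \<noteq> 0\<^sub>v n \<longrightarrow> v \<bullet> (M *\<^sub>v v) > 0)"

text \<open>The stacked matrix with block rows \<open>C\<close>, \<open>C A\<close>, ..., \<open>C A^(l-1)\<close>.\<close>

definition obs_mat :: "real mat \<Rightarrow> real mat \<Rightarrow> nat \<Rightarrow> real mat" where
  "obs_mat A C l = mat (dim_row C * l) (dim_row A)
     (\<lambda>(i, j). (C * A ^\<^sub>m (i div dim_row C)) $$ (i mod dim_row C, j))"

definition obs_rank :: "real mat \<Rightarrow> real mat \<Rightarrow> nat \<Rightarrow> nat" where
  "obs_rank A C l = vec_space.rank (dim_row C * l) (obs_mat A C l)"

definition observable :: "real mat \<Rightarrow> real mat \<Rightarrow> bool" where
  "observable A C \<longleftrightarrow> obs_rank A C (dim_row A) = dim_row A"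

definition observability_index :: "real mat \<Rightarrow> real mat \<Rightarrow> nat" where
  "observability_index A C = (LEAST l. 1 \<le> l \<and> obs_rank A C l = dim_row A)"

definition poly_at_mat :: "real poly \<Rightarrow> real mat \<Rightarrow> real mat" where
  "poly_at_mat q S = mat (dim_row S) (dim_row S)
     (\<lambda>(i, j). \<Sum>k\<le>degree q. coeff q k * (S ^\<^sub>m k) $$ (i, j))"

definition is_minimal_polynomial :: "real mat \<Rightarrow> real poly \<Rightarrow> bool" where
  "is_minimal_polynomial S q \<longleftrightarrow>
     lead_coeff q = 1 \<and> poly_at_mat q S = 0\<^sub>m (dim_row S) (dim_row S) \<and>
     (\<forall>r. r \<noteq> 0 \<and> poly_at_mat r S = 0\<^sub>m (dim_row S) (dim_row S) \<longrightarrow> degree q \<le> degree r)"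

text \<open>\<open>\<Phi>\<close> and \<open>G\<close> for a monic polynomial \<open>q\<close> of degree \<open>d\<close>. All blocks of \<open>\<Phi>\<close> are multiples of the
  identity of size \<open>p\<close>, so an entry can be nonzero only if row and column agree modulo \<open>p\<close>.\<close>

definition internal_model_Phi :: "nat \<Rightarrow> real poly \<Rightarrow> real mat" where
  "internal_model_Phi p q = (let d = degree q in mat (p * d) (p * d)
     (\<lambda>(i, j). if i mod p \<noteq> j mod p then 0
               else if i div p < d - 1 then (if j div p = i div p + 1 then 1 else 0)
               else - coeff q (j div p)))"

definition internal_model_G :: "nat \<Rightarrow> nat \<Rightarrow> real mat" where
  "internal_model_G p d = mat (p * d) p (\<lambda>(i, j). if i = p * (d - 1) + j then 1 else 0)"

text \<open>The stacked vector \<open>(z(k-l), \<dots>, z(k-1))\<close> of samples \<open>z(i)\<close> of length \<open>q\<close>, for \<open>k \<ge> l\<close>.\<close>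

definition stacked_window :: "nat \<Rightarrow> nat \<Rightarrow> (nat \<Rightarrow> real vec) \<Rightarrow> nat \<Rightarrow> real vec" where
  "stacked_window q l z k = vec (q * l) (\<lambda>i. z (k - l + i div q) $ (i mod q))"

definition data_psi ::
  "nat \<Rightarrow> nat \<Rightarrow> nat \<Rightarrow> (nat \<Rightarrow> real vec) \<Rightarrow> (nat \<Rightarrow> real vec) \<Rightarrow> (nat \<Rightarrow> real vec) \<Rightarrow> nat \<Rightarrow> real vec"
  where
  "data_psi m p l y u \<eta> k = stacked_window p l y k @\<^sub>v (stacked_window m l u k @\<^sub>v \<eta> k)"

text \<open>The matrix \<open>[f(a) f(a+1) \<cdots> f(b)]\<close> with \<open>r\<close> rows.\<close>

definition data_mat :: "nat \<Rightarrow> (nat \<Rightarrow> real vec) \<Rightarrow> nat \<Rightarrow> nat \<Rightarrow> real mat" where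
  "data_mat r f a b = mat_of_cols r (map f [a ..< b + 1])"

end

theory Submission
  imports Defs
begin

text \<open>The equality constraint contradicts the invertibility of \<open>X\<close>: data cleared of the
  exosignal cannot fill the whole space of the vectors \<open>\<psi>(k)\<close>.

  A vector \<open>a\<close> of weights turns the columns of the data matrices, which are shifted windows of one
  trajectory, into a superposed trajectory of the same linear plant on the times \<open>0, \<dots>, l\<close>. If
  \<open>M a = 0\<close>, the factorization of \<open>W\<^sub>0\<close> makes the superposed exosignal vanish at time \<open>l\<close>; the
  eigenvalue condition makes \<open>S\<close> injective, so the exosignal vanishes at all earlier times as well
  (\<open>superposed_exosignal_vanishes\<close>). What remains is an exosignal-free trajectory.

  If \<open>X\<close> is positive definite, it is surjective, and the weights \<open>a = Y z\<close> realize every prescribed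
  value \<open>X z\<close> of \<open>\<Psi>\<^sub>0 a\<close>, with \<open>M a = 0\<close>. In particular the input window can be chosen zero and the output window
  can be chosen freely among the \<open>p * l\<close>-dimensional vectors. However, with zero input and zero
  exosignal the output window is the image of an initial state under the observability matrix
  (\<open>free_output_window\<close>), and these vectors form a space of dimension at most \<open>n < p * l\<close>. A nonzero
  vector orthogonal to that space (\<open>wide_mat_kernel\<close>) gives the contradiction.\<close>

section \<open>Linear algebra\<close>

text \<open>Padding with zero rows makes the matrix square with determinant zero.\<close>

lemma wide_mat_kernel:
  fixes F :: "'a :: field mat"
  assumes F: "F \<in> carrier_mat r c" and rc: "r < c"
  obtains v where "v \<in> carrier_vec c" "v \<noteq> 0\<^sub>v c" "F *\<^sub>v v = 0\<^sub>v r"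
proof -
  define E where "E = mat\<^sub>r c c (\<lambda>i. if i = r then 0\<^sub>v c else if i < r then row F i else 0\<^sub>v c)"
  have E: "E \<in> carrier_mat c c"
    unfolding E_def by simp
  have "det E = 0"
    unfolding E_def
    by (rule det_row_0[OF rc]) (use F in auto)
  then obtain v where v: "v \<in> carrier_vec c" "v \<noteq> 0\<^sub>v c" "E *\<^sub>v v = 0\<^sub>v c"
    using det_0_iff_vec_prod_zero[OF E] by blast
  have "F *\<^sub>v v = 0\<^sub>v r"
  proof (rule eq_vecI)
    fix i assume i: "i < dim_vec (0\<^sub>v r :: 'a vec)"
    have "row E i = row F i"
      using i rc F by (intro eq_vecI) (auto simp: E_def)
    moreover have "(E *\<^sub>v v) $ i = 0"
      using v(3) i rc by simp
    ultimately show "(F *\<^sub>v v) $ i = 0\<^sub>v r $ i"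
      using i rc F E by simp
  qed (use F in simp)
  with v that show thesis by blast
qed

lemma injective_square_mat_surjective:
  fixes X :: "'a :: field mat"
  assumes X: "X \<in> carrier_mat n n"
    and inj: "\<And>v. v \<in> carrier_vec n \<Longrightarrow> X *\<^sub>v v = 0\<^sub>v n \<Longrightarrow> v = 0\<^sub>v n"
    and b: "b \<in> carrier_vec n"
  obtains z where "z \<in> carrier_vec n" "X *\<^sub>v z = b"
proof -
  have "det X \<noteq> 0"
    using det_0_iff_vec_prod_zero[OF X] inj by blast
  from det_non_zero_imp_unit[OF X this, of "()"]
  obtain R where R: "R \<in> carrier_mat n n" "X * R = 1\<^sub>m n"
    unfolding Units_def by (auto simp: ring_mat_def)
  have "X *\<^sub>v (R *\<^sub>v b) = b"
    using assoc_mult_mat_vec[OF X R(1) b] R(2) b by simp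
  moreover have "R *\<^sub>v b \<in> carrier_vec n"
    using R(1) b by simp
  ultimately show thesis using that by blast
qed

lemma pos_def_mat_surjective:
  assumes X: "pos_def_mat n X" and b: "b \<in> carrier_vec n"
  obtains z where "z \<in> carrier_vec n" "X *\<^sub>v z = b"
proof (rule injective_square_mat_surjective[OF _ _ b])
  show "X \<in> carrier_mat n n"
    using X unfolding pos_def_mat_def by simp
  fix v assume v: "v \<in> carrier_vec n" "X *\<^sub>v v = 0\<^sub>v n"
  show "v = 0\<^sub>v n"
  proof (rule ccontr)
    assume "v \<noteq> 0\<^sub>v n"
    then have "v \<bullet> (X *\<^sub>v v) > 0"
      using X v(1) unfolding pos_def_mat_def by blast
    then show False using v by simp
  qed
qed (use that in blast)

text \<open>A nonzero kernel vector would be an eigenvector for the eigenvalue 0.\<close>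

lemma injective_if_eigenvalues_outside_disc:
  fixes S :: "real mat"
  assumes S: "S \<in> carrier_mat n n"
    and ev: "\<forall>z. eigenvalue (map_mat complex_of_real S) z \<longrightarrow> 1 \<le> cmod z"
    and v: "v \<in> carrier_vec n" and Sv: "S *\<^sub>v v = 0\<^sub>v n"
  shows "v = 0\<^sub>v n"
proof (rule ccontr)
  assume v0: "v \<noteq> 0\<^sub>v n"
  let ?S = "map_mat complex_of_real S" and ?v = "map_vec complex_of_real v"
  have "?S *\<^sub>v ?v = map_vec complex_of_real (S *\<^sub>v v)"
    by (rule of_real_hom.mult_mat_vec_hom[OF S v, symmetric])
  also have "\<dots> = 0 \<cdot>\<^sub>v ?v"
    using v by (auto simp: Sv)
  finally have "eigenvector ?S ?v 0"
    using v v0 S unfolding eigenvector_def by simp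
  then have "eigenvalue ?S 0"
    unfolding eigenvalue_def by blast
  with ev show False by force
qed

section \<open>Superpositions of shifted data windows\<close>

lemma data_mat_carrier [simp]: "data_mat r f a b \<in> carrier_mat r (b + 1 - a)"
  unfolding data_mat_def by (rule carrier_matI) auto

lemma data_mat_index:
  "i < r \<Longrightarrow> j < b + 1 - a \<Longrightarrow> data_mat r f a b $$ (i, j) = f (a + j) $ i"
  unfolding data_mat_def by (subst mat_of_cols_index) (auto simp del: upt_Suc)

text \<open>Fixing the weights \<open>a\<close> and varying the first time \<open>i\<close> of the data window makes this a signal
  in \<open>i\<close>, on which linear recursions can be read off.\<close>

definition superposition ::
  "nat \<Rightarrow> nat \<Rightarrow> real vec \<Rightarrow> (nat \<Rightarrow> real vec) \<Rightarrow> nat \<Rightarrow> real vec" where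
  "superposition r K a f i = data_mat r f i (i + K) *\<^sub>v a"

lemma superposition_carrier [simp]: "superposition r K a f i \<in> carrier_vec r"
  unfolding superposition_def carrier_vec_def by (simp add: data_mat_def)

lemma superposition_dim [simp]: "dim_vec (superposition r K a f i) = r"
  using superposition_carrier[of r K a f i] by (rule carrier_vecD)

lemma superposition_index:
  assumes "a \<in> carrier_vec (K + 1)" "s < r"
  shows "superposition r K a f i $ s = (\<Sum>j<K + 1. f (i + j) $ s * a $ j)"
proof -
  have "superposition r K a f i $ s = row (data_mat r f i (i + K)) s \<bullet> a"
    unfolding superposition_def
    by (rule index_mult_mat_vec) (use assms in \<open>simp add: data_mat_def\<close>)
  also have "\<dots> = (\<Sum>j<K + 1. data_mat r f i (i + K) $$ (s, j) * a $ j)"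
    unfolding scalar_prod_def atLeast0LessThan using assms
    by (intro sum.cong) (auto simp: data_mat_def)
  also have "\<dots> = (\<Sum>j<K + 1. f (i + j) $ s * a $ j)"
    using assms by (intro sum.cong refl) (simp add: data_mat_index)
  finally show ?thesis .
qed

lemma superposition_mult:
  assumes a: "a \<in> carrier_vec (K + 1)" and F: "F \<in> carrier_mat r c"
    and g: "\<And>k. i \<le> k \<Longrightarrow> k \<le> i + K \<Longrightarrow> g k \<in> carrier_vec c"
  shows "superposition r K a (\<lambda>k. F *\<^sub>v g k) i = F *\<^sub>v superposition c K a g i"
proof (rule eq_vecI)
  fix s assume "s < dim_vec (F *\<^sub>v superposition c K a g i)"
  then have s: "s < r" using F by simp
  have "superposition r K a (\<lambda>k. F *\<^sub>v g k) i $ s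
      = (\<Sum>j<K + 1. (\<Sum>t<c. F $$ (s, t) * g (i + j) $ t) * a $ j)"
    unfolding superposition_index[OF a s]
  proof (intro sum.cong refl arg_cong2[where f = "(*)"])
    fix j assume "j \<in> {..<K + 1}"
    then have "g (i + j) \<in> carrier_vec c" using g by simp
    then show "(F *\<^sub>v g (i + j)) $ s = (\<Sum>t<c. F $$ (s, t) * g (i + j) $ t)"
      using F s by (auto simp: scalar_prod_def atLeast0LessThan intro!: sum.cong)
  qed
  also have "\<dots> = (\<Sum>t<c. F $$ (s, t) * (\<Sum>j<K + 1. g (i + j) $ t * a $ j))"
    unfolding sum_distrib_left sum_distrib_right mult.assoc by (rule sum.swap)
  also have "\<dots> = (\<Sum>t<c. F $$ (s, t) * superposition c K a g i $ t)"
    by (intro sum.cong refl) (simp only: superposition_index[OF a] lessThan_iff)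
  also have "\<dots> = (F *\<^sub>v superposition c K a g i) $ s"
    using F s by (simp add: scalar_prod_def atLeast0LessThan)
  finally show "superposition r K a (\<lambda>k. F *\<^sub>v g k) i $ s
      = (F *\<^sub>v superposition c K a g i) $ s" .
qed (use F in simp)

lemma superposition_add:
  assumes a: "a \<in> carrier_vec (K + 1)"
    and g: "\<And>k. i \<le> k \<Longrightarrow> k \<le> i + K \<Longrightarrow> g k \<in> carrier_vec r"
  shows "superposition r K a (\<lambda>k. f k + g k) i = superposition r K a f i + superposition r K a g i"
proof (rule eq_vecI)
  fix s assume "s < dim_vec (superposition r K a f i + superposition r K a g i)"
  then have s: "s < r" by simp
  have "superposition r K a (\<lambda>k. f k + g k) i $ s
      = (\<Sum>j<K + 1. f (i + j) $ s * a $ j + g (i + j) $ s * a $ j)"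
    unfolding superposition_index[OF a s]
  proof (intro sum.cong refl)
    fix j assume "j \<in> {..<K + 1}"
    then have "g (i + j) \<in> carrier_vec r" using g by simp
    then show "(f (i + j) + g (i + j)) $ s * a $ j = f (i + j) $ s * a $ j + g (i + j) $ s * a $ j"
      using s by (simp add: distrib_right)
  qed
  then show "superposition r K a (\<lambda>k. f k + g k) i $ s
      = (superposition r K a f i + superposition r K a g i) $ s"
    using s by (simp only: sum.distrib superposition_index[OF a s] index_add_vec superposition_dim)
qed simp

lemma superposition_cong:
  assumes a: "a \<in> carrier_vec (K + 1)"
    and "\<And>k. k \<le> K \<Longrightarrow> f (i + k) = g (i' + k)"
  shows "superposition r K a f i = superposition r K a g i'"
  using assms(2) by (intro eq_vecI) (simp_all add: superposition_index[OF a] del: sum.lessThan_Suc)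

section \<open>Exosignal-free trajectories\<close>

lemma superposed_exosignal_vanishes:
  assumes a: "a \<in> carrier_vec (K + 1)" and S: "S \<in> carrier_mat r r"
    and ev: "\<forall>z. eigenvalue (map_mat complex_of_real S) z \<longrightarrow> 1 \<le> cmod z"
    and w: "\<And>k. k \<le> l + K \<Longrightarrow> w k \<in> carrier_vec r"
    and step: "\<And>k. k < l + K \<Longrightarrow> w (k + 1) = S *\<^sub>v w k"
    and final: "superposition r K a w l = 0\<^sub>v r"
  shows "i \<le> l \<Longrightarrow> superposition r K a w i = 0\<^sub>v r"
proof (induction i rule: inc_induct)
  case (step i)
  have "S *\<^sub>v superposition r K a w i = superposition r K a (\<lambda>k. S *\<^sub>v w k) i"
    by (rule superposition_mult[OF a S, symmetric]) (use w step.hyps in auto)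
  also have "\<dots> = superposition r K a w (Suc i)"
    by (rule superposition_cong[OF a]) (use assms(5) step.hyps in \<open>simp flip: Suc_eq_plus1\<close>)
  also have "\<dots> = 0\<^sub>v r" by (rule step.IH)
  finally show ?case
    by (rule injective_if_eigenvalues_outside_disc[OF S ev superposition_carrier])
qed (rule final)

text \<open>Iterating the state equation gives \<open>x i = A\<^sup>i (x 0)\<close>, so the samples \<open>C (x i)\<close> are the blocks
  of the observability matrix applied to the initial state.\<close>

lemma free_output_window:
  assumes A: "A \<in> carrier_mat n n" and C: "C \<in> carrier_mat p n"
    and x0: "x 0 \<in> carrier_vec n"
    and step: "\<And>i. i < l \<Longrightarrow> x (Suc i) = A *\<^sub>v x i"
    and v: "v \<in> carrier_vec (p * l)"
    and window: "\<And>i s. i < l \<Longrightarrow> s < p \<Longrightarrow> v $ (i * p + s) = (C *\<^sub>v x i) $ s"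
  shows "v = obs_mat A C l *\<^sub>v x 0"
proof (rule eq_vecI)
  have power: "x i = A ^\<^sub>m i *\<^sub>v x 0" if "i \<le> l" for i
    using that
  proof (induction i)
    case 0
    then show ?case using A x0 by simp
  next
    case (Suc i)
    have "A ^\<^sub>m Suc i = A * A ^\<^sub>m i"
    proof (induction i)
      case (Suc i)
      then show ?case
        using assoc_mult_mat[OF A pow_carrier_mat[OF A] A, of i] by simp
    qed (use A in simp)
    then show ?case
      using Suc step[of i] assoc_mult_mat_vec[OF A pow_carrier_mat[OF A] x0] by simp
  qed
  fix r assume "r < dim_vec (obs_mat A C l *\<^sub>v x 0)"
  then have r: "r < p * l" using C by (simp add: obs_mat_def)
  then have p: "p > 0" by (cases p) auto
  have i: "r div p < l" and s: "r mod p < p"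
    using r p by (simp_all add: less_mult_imp_div_less mult.commute)
  have "v $ r = (C *\<^sub>v (A ^\<^sub>m (r div p) *\<^sub>v x 0)) $ (r mod p)"
    using window[OF i s] power[of "r div p"] i by simp
  also have "\<dots> = ((C * A ^\<^sub>m (r div p)) *\<^sub>v x 0) $ (r mod p)"
    using assoc_mult_mat_vec[OF C pow_carrier_mat[OF A] x0] by simp
  also have "\<dots> = (obs_mat A C l *\<^sub>v x 0) $ r"
    using r s A C x0 by (simp add: obs_mat_def scalar_prod_def)
  finally show "v $ r = (obs_mat A C l *\<^sub>v x 0) $ r" .
qed (use v C in \<open>simp add: obs_mat_def\<close>)

section \<open>Infeasibility of the semidefinite program\<close>

theorem proposition4p3:
  fixes n m p n\<^sub>w l d T nhat N :: nat
    and A B P C Q S L\<^sub>0 M :: "real mat"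
    and q :: "real poly"
    and w x u y \<eta> :: "nat \<Rightarrow> real vec"
  defines "d \<equiv> degree q"
    and "N \<equiv> (m + p) * l + p * d"
  defines "\<Phi> \<equiv> internal_model_Phi p q"
    and "G \<equiv> internal_model_G p d"
    and "\<psi> \<equiv> data_psi m p l y u \<eta>"
  defines "\<Psi>\<^sub>0 \<equiv> data_mat N \<psi> l T"
    and "\<Psi>\<^sub>1 \<equiv> data_mat N \<psi> (l + 1) (T + 1)"
    and "W\<^sub>0 \<equiv> data_mat n\<^sub>w w l T"
  assumes plant_dims: "S \<in> carrier_mat n\<^sub>w n\<^sub>w" "A \<in> carrier_mat n n" "B \<in> carrier_mat n m"
      "P \<in> carrier_mat n n\<^sub>w" "C \<in> carrier_mat p n" "Q \<in> carrier_mat p n\<^sub>w"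
    and S_eigenvalues: "\<forall>z. eigenvalue (map_mat complex_of_real S) z \<longrightarrow> 1 \<le> cmod z"
    and min_poly: "is_minimal_polynomial S q"
    and obs: "observable A C"
    and obs_index: "l = observability_index A C"
    and T: "l \<le> T"
    and init: "w 0 \<in> carrier_vec n\<^sub>w" "x 0 \<in> carrier_vec n" "\<eta> 0 \<in> carrier_vec (p * d)"
    and inputs: "\<forall>k\<le>T. u k \<in> carrier_vec m"
    and exosystem: "\<forall>k\<le>T. w (k + 1) = S *\<^sub>v w k"
    and plant: "\<forall>k\<le>T. x (k + 1) = A *\<^sub>v x k + B *\<^sub>v u k + P *\<^sub>v w k"
    and measurement: "\<forall>k\<le>T. y k = C *\<^sub>v x k + Q *\<^sub>v w k"
    and internal_model: "\<forall>k\<le>T. \<eta> (k + 1) = \<Phi> *\<^sub>v \<eta> k + G *\<^sub>v y k"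
    and L\<^sub>0: "L\<^sub>0 \<in> carrier_mat n\<^sub>w nhat"
    and M: "M \<in> carrier_mat nhat (T - l + 1)"
    and W\<^sub>0_factor: "W\<^sub>0 = L\<^sub>0 * M"
    and M_full_row_rank: "vec_space.rank nhat M = nhat"
    and size: "p * l > n"
  shows "\<not> (\<exists>X Y. X \<in> carrier_mat N N \<and> Y \<in> carrier_mat (T - l + 1) N \<and>
            pos_def_mat N X \<and>
            X @\<^sub>r 0\<^sub>m nhat N = (\<Psi>\<^sub>0 @\<^sub>r M) * Y \<and>
            pos_def_mat (2 * N)
              (four_block_mat X (\<Psi>\<^sub>1 * Y)
                              ((\<Psi>\<^sub>1 * Y)\<^sup>T) X))"
proof
  assume "\<exists>X Y. X \<in> carrier_mat N N \<and> Y \<in> carrier_mat (T - l + 1) N \<and>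
      pos_def_mat N X \<and> X @\<^sub>r 0\<^sub>m nhat N = (\<Psi>\<^sub>0 @\<^sub>r M) * Y \<and>
      pos_def_mat (2 * N) (four_block_mat X (\<Psi>\<^sub>1 * Y) ((\<Psi>\<^sub>1 * Y)\<^sup>T) X)"
  then obtain X Y where X: "X \<in> carrier_mat N N" and Y: "Y \<in> carrier_mat (T - l + 1) N"
    and pos: "pos_def_mat N X" and constr: "X @\<^sub>r 0\<^sub>m nhat N = (\<Psi>\<^sub>0 @\<^sub>r M) * Y"
    by blast
  define K where "K = T - l"
  have TK: "T = l + K" unfolding K_def using T by simp
  have NK: "N = p * l + (m * l + p * d)"
    unfolding N_def by (simp add: algebra_simps)
  have w_carrier: "w k \<in> carrier_vec n\<^sub>w" if "k \<le> T + 1" for k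
    using that init(1) exosystem plant_dims(1) by (induction k) auto
  have x_carrier: "x k \<in> carrier_vec n" if "k \<le> T + 1" for k
    using that
  proof (induction k)
    case (Suc k)
    then show ?case
      using plant[rule_format, of k] inputs[rule_format, of k] w_carrier[of k] plant_dims
      by (simp add: add_carrier_vec[OF add_carrier_vec])
  qed (use init(2) in simp)

  have O: "(obs_mat A C l)\<^sup>T \<in> carrier_mat n (p * l)"
    using plant_dims(2,5) by (simp add: obs_mat_def)
  obtain v where v: "v \<in> carrier_vec (p * l)" "v \<noteq> 0\<^sub>v (p * l)"
      and vO: "(obs_mat A C l)\<^sup>T *\<^sub>v v = 0\<^sub>v n"
    using wide_mat_kernel[OF O size] by metis

  \<comment> \<open>The prescribed data vector: output window \<open>v\<close>, zero input window. By the
    choice of \<open>v\<close>, no free motion of the plant has this output window.\<close>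
  define b where "b = v @\<^sub>v 0\<^sub>v (m * l + p * d)"
  have b: "b \<in> carrier_vec N"
    unfolding b_def NK using v(1) by simp
  obtain z where z: "z \<in> carrier_vec N" and Xz: "X *\<^sub>v z = b"
    using pos_def_mat_surjective[OF pos b] .
  define a where "a = Y *\<^sub>v z"
  have a: "a \<in> carrier_vec (K + 1)"
    unfolding a_def K_def using Y z by simp
  have Psi0: "\<Psi>\<^sub>0 \<in> carrier_mat N (T - l + 1)"
    unfolding \<Psi>\<^sub>0_def using data_mat_carrier[of N \<psi> l T] T by (simp add: Suc_diff_le)
  have "b @\<^sub>v 0\<^sub>v nhat = (X @\<^sub>r 0\<^sub>m nhat N) *\<^sub>v z"
  proof -
    have "0\<^sub>m nhat N *\<^sub>v z = 0\<^sub>v nhat" using z by auto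
    then show ?thesis
      using mat_mult_append[OF X zero_carrier_mat z] Xz by metis
  qed
  also have "\<dots> = (\<Psi>\<^sub>0 @\<^sub>r M) *\<^sub>v a"
    unfolding constr a_def
    by (rule assoc_mult_mat_vec[OF carrier_append_rows[OF Psi0 M] Y z])
  also have "\<dots> = \<Psi>\<^sub>0 *\<^sub>v a @\<^sub>v M *\<^sub>v a"
    by (rule mat_mult_append[OF Psi0 M]) (use a K_def in simp)
  finally have "b = \<Psi>\<^sub>0 *\<^sub>v a \<and> 0\<^sub>v nhat = M *\<^sub>v a"
    using append_vec_eq[OF b mult_mat_vec_carrier[OF Psi0]] a K_def by simp
  then have Psi0a: "superposition N K a \<psi> l = b" and Ma: "M *\<^sub>v a = 0\<^sub>v nhat"
    by (simp_all add: superposition_def \<Psi>\<^sub>0_def TK)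

  have "superposition n\<^sub>w K a w l = W\<^sub>0 *\<^sub>v a"
    by (simp add: superposition_def W\<^sub>0_def TK)
  also have "\<dots> = L\<^sub>0 *\<^sub>v (M *\<^sub>v a)"
    unfolding W\<^sub>0_factor by (rule assoc_mult_mat_vec[OF L\<^sub>0 M]) (use a K_def in simp)
  also have "\<dots> = 0\<^sub>v n\<^sub>w"
    unfolding Ma using L\<^sub>0 by auto
  finally have w_final: "superposition n\<^sub>w K a w l = 0\<^sub>v n\<^sub>w" .
  have w_zero: "superposition n\<^sub>w K a w i = 0\<^sub>v n\<^sub>w" if "i \<le> l" for i
    by (rule superposed_exosignal_vanishes[OF a plant_dims(1) S_eigenvalues _ _ w_final that])
      (use w_carrier exosystem TK in auto)

  \<comment> \<open>The output and input blocks of \<open>\<Psi>\<^sub>0 a = b\<close> are the superposed samples at the times \<open>0, \<dots>, l - 1\<close>.\<close>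
  have y_window: "v $ (i * p + s) = superposition p K a y i $ s" if i: "i < l" and s: "s < p" for i s
  proof -
    have "i * p + s < Suc i * p" using s by simp
    also have "\<dots> \<le> l * p" using i by (intro mult_right_mono) auto
    finally have r: "i * p + s < p * l" by (simp add: mult.commute)
    then have rN: "i * p + s < N" unfolding NK by simp
    have "\<psi> (l + j) $ (i * p + s) = y (i + j) $ s" for j
      using r s by (simp add: \<psi>_def data_psi_def stacked_window_def add.commute)
    then have "superposition N K a \<psi> l $ (i * p + s) = superposition p K a y i $ s"
      unfolding superposition_index[OF a rN] superposition_index[OF a s] by simp
    then show ?thesis
      unfolding Psi0a using r v(1) by (simp add: b_def)
  qed
  have u_zero: "superposition m K a u i = 0\<^sub>v m" if i: "i < l" for i
  proof (rule eq_vecI)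
    fix s assume "s < dim_vec (0\<^sub>v m :: real vec)"
    then have s: "s < m" by simp
    have "i * m + s < Suc i * m" using s by simp
    also have "\<dots> \<le> l * m" using i by (intro mult_right_mono) auto
    finally have r: "i * m + s < m * l" by (simp add: mult.commute)
    then have rN: "p * l + (i * m + s) < N" unfolding NK by simp
    have "\<psi> (l + j) $ (p * l + (i * m + s)) = u (i + j) $ s" for j
      using r s by (simp add: \<psi>_def data_psi_def stacked_window_def add.commute)
    then have "superposition N K a \<psi> l $ (p * l + (i * m + s)) = superposition m K a u i $ s"
      unfolding superposition_index[OF a rN] superposition_index[OF a s] by simp
    then show "superposition m K a u i $ s = 0\<^sub>v m $ s"
      unfolding Psi0a using r s v(1) by (simp add: b_def)
  qed simp

  have x_step: "superposition n K a x (Suc i) = A *\<^sub>v superposition n K a x i" if i: "i < l" for i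
  proof -
    have car: "A *\<^sub>v x k \<in> carrier_vec n" "B *\<^sub>v u k \<in> carrier_vec n" "P *\<^sub>v w k \<in> carrier_vec n"
      if "k \<le> i + K" for k
      using that i TK plant_dims x_carrier[of k] w_carrier[of k] inputs by auto
    have "superposition n K a x (Suc i)
        = superposition n K a (\<lambda>k. A *\<^sub>v x k + B *\<^sub>v u k + P *\<^sub>v w k) i"
      by (rule superposition_cong[OF a]) (use i TK plant in \<open>simp flip: Suc_eq_plus1\<close>)
    also have "\<dots> = superposition n K a (\<lambda>k. A *\<^sub>v x k) i + superposition n K a (\<lambda>k. B *\<^sub>v u k) i
        + superposition n K a (\<lambda>k. P *\<^sub>v w k) i"
      using car by (simp add: superposition_add[OF a])
    also have "\<dots> = A *\<^sub>v superposition n K a x i + B *\<^sub>v superposition m K a u i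
        + P *\<^sub>v superposition n\<^sub>w K a w i"
      using i TK x_carrier w_carrier inputs
      by (simp add: superposition_mult[OF a plant_dims(2)] superposition_mult[OF a plant_dims(3)]
          superposition_mult[OF a plant_dims(4)])
    also have "\<dots> = A *\<^sub>v superposition n K a x i"
    proof -
      have "B *\<^sub>v 0\<^sub>v m = 0\<^sub>v n" "P *\<^sub>v 0\<^sub>v n\<^sub>w = 0\<^sub>v n"
        using plant_dims(3,4) by auto
      then show ?thesis
        using u_zero[OF i] w_zero[of i] i plant_dims(2)
          mult_mat_vec_carrier[OF plant_dims(2) superposition_carrier] by simp
    qed
    finally show ?thesis .
  qed
  have y_eq: "superposition p K a y i = C *\<^sub>v superposition n K a x i" if i: "i < l" for i
  proof -
    have "superposition p K a y i = superposition p K a (\<lambda>k. C *\<^sub>v x k + Q *\<^sub>v w k) i"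
      by (rule superposition_cong[OF a]) (use i TK measurement in simp)
    also have "\<dots> = superposition p K a (\<lambda>k. C *\<^sub>v x k) i + superposition p K a (\<lambda>k. Q *\<^sub>v w k) i"
      by (rule superposition_add[OF a]) (use i TK plant_dims w_carrier in auto)
    also have "\<dots> = C *\<^sub>v superposition n K a x i + Q *\<^sub>v superposition n\<^sub>w K a w i"
      using i TK x_carrier w_carrier
      by (simp add: superposition_mult[OF a plant_dims(5)] superposition_mult[OF a plant_dims(6)])
    also have "\<dots> = C *\<^sub>v superposition n K a x i"
    proof -
      have "Q *\<^sub>v 0\<^sub>v n\<^sub>w = 0\<^sub>v p"
        using plant_dims(6) by auto
      then show ?thesis
        using w_zero[of i] i mult_mat_vec_carrier[OF plant_dims(5) superposition_carrier] by simp
    qed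
    finally show ?thesis .
  qed

  let ?x = "superposition n K a x"
  have "v = obs_mat A C l *\<^sub>v ?x 0"
    by (rule free_output_window[where x = ?x, OF plant_dims(2,5) superposition_carrier x_step v(1)])
      (simp_all add: y_window y_eq)
  then have "v \<bullet> v = v \<bullet> (obs_mat A C l *\<^sub>v ?x 0)" by simp
  also have "\<dots> = ((obs_mat A C l)\<^sup>T *\<^sub>v v) \<bullet> ?x 0"
    by (rule transpose_vec_mult_scalar[symmetric, OF _ superposition_carrier v(1)])
      (use O in auto)
  also have "\<dots> = 0"
    unfolding vO by simp
  finally have "v \<bullet> v = 0" .
  then show False
    using conjugate_square_eq_0_vec[OF v(1)] v(2) by simp
qed

end
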